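(* Let $B_{0,1}=B[\mathbf{c}_{0,1};r]$ be a closed ball with $r>0$ and $\mathbf{s}\in B_{0,1}$, let $\{\mathcal{C}_k\}_{k\ge 0}$ be the sequence of finite families of closed balls defined in the context, starting from $\mathcal{C}_0=\{B_{0,1}\}$, and for each $k\ge 1$ let $\mathbf{z}_k$ be the center of an arbitrarily chosen ball of $\mathcal{C}_k$. Let $\delta>0$. Consider, for $k\ge 1$, the stopping criterion consisting of the two conditions: (1) $\rho(\mathbf{c}';\mathbf{c}'')<\frac23\delta$ for any two balls $B[\mathbf{c}';r_k],B[\mathbf{c}'';r_k]\in\mathcal{C}_k$; (2) $r_k<\frac13\delta$. Then there exists $k\ge 1$ for which both conditions hold (so the process that halts at the first such $k$ terminates after finitely many steps), and for the $k$ at which it halts one has $\rho(\mathbf{z}_k;\mathbf{s})<\delta$.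
   Context: Setting: $(X;\rho)$ is a metric space which is proper, i.e. every closed ball is compact. $B[\mathbf{c};r]=\{\mathbf{x}\in X\mid\rho(\mathbf{x};\mathbf{c})\le r\}$ is the closed ball; balls are regarded as given together with their center and radius. $\mathbf{r}_1,\dots,\mathbf{r}_n\in X$ ($n\ge 1$) are pairwise distinct points (sensors), $\mathbf{s}\in X$ (the source), $t_0\in\mathbb{R}$, and $t_i=t_0+\rho(\mathbf{r}_i;\mathbf{s})$ for $i=1,\dots,n$. A solution of the sound ranging problem $(\{\mathbf{r}_i\};\{t_i\})$ is a pair $(\mathbf{s}';t')\in X\times\mathbb{R}$ with $t_i=t'+\rho(\mathbf{r}_i;\mathbf{s}')$ for all $i=1,\dots,n$; since $t'$ is determined by $\mathbf{s}'$, the point $\mathbf{s}'$ itself is also called a solution. It is assumed that the solution $\mathbf{s}$ is unique. Definitions: for $\mathbf{x}\in X$, $\tau_i(\mathbf{x})=t_i-\rho(\mathbf{x};\mathbf{r}_i)$, and the defect is $D(\mathbf{x})=\frac1n\sum_{i=1}^n\bigl|\tau_i(\mathbf{x})-\frac1n\sum_{j=1}^n\tau_j(\mathbf{x})\bigr|$. A closed ball $B[\mathbf{c};r]$ belongs to the class $\mathcal{N}$ (negative) if $2r<D(\mathbf{c})$, and to the class $\mathcal{S}$ (suspicious) otherwise, i.e. if $D(\mathbf{c})\le 2r$. Refining covers: fix a real constant $K_1\ge 1$ and, for every closed ball $B=B[\mathbf{z};r]$ with $r>0$, a finite family $\mathcal{B}(B)$ of closed balls of radius $\frac r2$ whose union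 contains $B$ and whose centers $\mathbf{c}$ all satisfy $\rho(\mathbf{c};\mathbf{z})\le K_1 r$. Process: $r_k=r/2^k$ and $\mathcal{C}_0=\{B_{0,1}\}$. For $k\ge 0$, $\mathcal{C}_{k+1}$ is the family of all balls $B'=B[\mathbf{c};r_{k+1}]$ such that $B'\in\mathcal{B}(B)$ for some $B\in\mathcal{C}_k$ and $B'\in\mathcal{S}$. (Each $\mathcal{C}_k$ is nonempty.) *)

theory Defs
  imports "HOL-Analysis.Analysis"
begin

text \<open>
  Sensors are \<open>R 1, \<dots>, R n\<close> and arrival times are \<open>t 1, \<dots>, t n\<close>; values of \<open>R\<close> and \<open>t\<close> outside
  \<open>{1..n}\<close> are irrelevant. A closed ball is given together with its center and radius, so it is
  represented by the pair \<open>(c, \<rho>)\<close>, whose underlying point set is \<open>cball c \<rho>\<close>.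
\<close>

type_synonym 'a cball = "'a \<times> real"

definition sr_solution ::
    "nat \<Rightarrow> (nat \<Rightarrow> 'a::metric_space) \<Rightarrow> (nat \<Rightarrow> real) \<Rightarrow> 'a \<times> real \<Rightarrow> bool" where
  "sr_solution n R t p \<longleftrightarrow> (\<forall>i\<in>{1..n}. t i = snd p + dist (R i) (fst p))"

definition tau :: "(nat \<Rightarrow> 'a::metric_space) \<Rightarrow> (nat \<Rightarrow> real) \<Rightarrow> nat \<Rightarrow> 'a \<Rightarrow> real" where
  "tau R t i x = t i - dist x (R i)"

definition defect :: "nat \<Rightarrow> (nat \<Rightarrow> 'a::metric_space) \<Rightarrow> (nat \<Rightarrow> real) \<Rightarrow> 'a \<Rightarrow> real" where
  "defect n R t x =
     (1 / real n) * (\<Sum>i=1..n. \<bar>tau R t i x - (1 / real n) * (\<Sum>j=1..n. tau R t j x)\<bar>)"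

definition negative ::
    "nat \<Rightarrow> (nat \<Rightarrow> 'a::metric_space) \<Rightarrow> (nat \<Rightarrow> real) \<Rightarrow> 'a cball \<Rightarrow> bool" where
  "negative n R t B \<longleftrightarrow> 2 * snd B < defect n R t (fst B)"

definition suspicious ::
    "nat \<Rightarrow> (nat \<Rightarrow> 'a::metric_space) \<Rightarrow> (nat \<Rightarrow> real) \<Rightarrow> 'a cball \<Rightarrow> bool" where
  "suspicious n R t B \<longleftrightarrow> \<not> negative n R t B"

definition refining_covers :: "real \<Rightarrow> ('a::metric_space cball \<Rightarrow> 'a cball set) \<Rightarrow> bool" where
  "refining_covers K \<B> \<longleftrightarrow>
     (\<forall>z \<rho>. \<rho> > 0 \<longrightarrow>
        finite (\<B> (z, \<rho>)) \<and>
        (\<forall>(c, \<sigma>)\<in>\<B> (z, \<rho>). \<sigma> = \<rho> / 2 \<and> dist c z \<le> K * \<rho>) \<and>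
        cball z \<rho> \<subseteq> (\<Union>(c, \<sigma>)\<in>\<B> (z, \<rho>). cball c \<sigma>))"

primrec refinement ::
    "nat \<Rightarrow> (nat \<Rightarrow> 'a::metric_space) \<Rightarrow> (nat \<Rightarrow> real) \<Rightarrow> ('a cball \<Rightarrow> 'a cball set) \<Rightarrow>
     'a \<Rightarrow> real \<Rightarrow> nat \<Rightarrow> 'a cball set" where
  "refinement n R t \<B> c0 r 0 = {(c0, r)}"
| "refinement n R t \<B> c0 r (Suc k) =
     {(c, r / 2 ^ Suc k) | c. \<exists>B\<in>refinement n R t \<B> c0 r k.
        (c, r / 2 ^ Suc k) \<in> \<B> B \<and> suspicious n R t (c, r / 2 ^ Suc k)}"

definition stop_criterion :: "(nat \<Rightarrow> 'a::metric_space cball set) \<Rightarrow> real \<Rightarrow> real \<Rightarrow> nat \<Rightarrow> bool" where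
  "stop_criterion \<C> r \<delta> k \<longleftrightarrow>
     (\<forall>c' c''. (c', r / 2 ^ k) \<in> \<C> k \<longrightarrow> (c'', r / 2 ^ k) \<in> \<C> k \<longrightarrow> dist c' c'' < 2 / 3 * \<delta>) \<and>
     r / 2 ^ k < 1 / 3 * \<delta>"

end

(* Since the defect is 2-Lipschitz and vanishes at the source, every ball containing the source is
   suspicious; hence the source lies in some ball of each refinement. By uniqueness the source is the
   only zero of the defect, so on a compact set with a neighbourhood of the source removed the defect
   is bounded below by a positive constant. All centers stay in one bounded set and their defect is
   at most twice the radius, so they converge uniformly to the source. *)

theory Submission
  imports Defs
begin

text \<open>Each \<open>tau R t i\<close> is 1-Lipschitz, hence so is their mean. A deviation from
  the mean therefore changes by at most \<open>2 * dist x y\<close>, and averaging keeps this bound.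
  The constant 2 matches the factor 2 in \<open>negative\<close>.\<close>

lemma defect_lipschitz:
  fixes R :: "nat \<Rightarrow> 'a::metric_space"
  shows "defect n R t x \<le> defect n R t y + 2 * dist x y"
proof (cases "n = 0")
  \<comment> \<open>Division by zero yields 0, so the defect is identically 0 here.\<close>
  case True
  then show ?thesis by (simp add: defect_def)
next
  case False
  define m where "m u = (1 / real n) * (\<Sum>j=1..n. tau R t j u)" for u
  have tau: "\<bar>tau R t i x - tau R t i y\<bar> \<le> dist x y" for i
    unfolding tau_def
    using dist_triangle[of x "R i" y] dist_triangle[of y "R i" x] by (simp add: dist_commute)
  have "\<bar>(\<Sum>j=1..n. tau R t j x) - (\<Sum>j=1..n. tau R t j y)\<bar>
      \<le> (\<Sum>j=1..n. \<bar>tau R t j x - tau R t j y\<bar>)"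
    unfolding sum_subtractf[symmetric] by (rule sum_abs)
  also have "\<dots> \<le> real n * dist x y"
    using sum_bounded_above[of "{1..n}" "\<lambda>j. \<bar>tau R t j x - tau R t j y\<bar>" "dist x y"] tau by simp
  finally have "\<bar>(\<Sum>j=1..n. tau R t j x) - (\<Sum>j=1..n. tau R t j y)\<bar> / real n \<le> dist x y"
    using False by (simp add: divide_le_eq mult.commute)
  moreover have "m x - m y = ((\<Sum>j=1..n. tau R t j x) - (\<Sum>j=1..n. tau R t j y)) / real n"
    by (simp add: m_def diff_divide_distrib)
  ultimately have mean: "\<bar>m x - m y\<bar> \<le> dist x y"
    by (simp add: abs_divide)
  have term_le: "\<bar>tau R t i x - m x\<bar> \<le> \<bar>tau R t i y - m y\<bar> + 2 * dist x y" for i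
    using tau[of i] mean by linarith
  have "(\<Sum>i=1..n. \<bar>tau R t i x - m x\<bar>) \<le> (\<Sum>i=1..n. \<bar>tau R t i y - m y\<bar> + 2 * dist x y)"
    by (intro sum_mono term_le)
  also have "\<dots> = (\<Sum>i=1..n. \<bar>tau R t i y - m y\<bar>) + real n * (2 * dist x y)"
    by (simp add: sum.distrib)
  finally show ?thesis
    using False unfolding defect_def m_def[symmetric] by (simp add: field_simps)
qed

lemma continuous_on_defect:
  fixes R :: "nat \<Rightarrow> 'a::metric_space"
  shows "continuous_on A (defect n R t)"
  unfolding defect_def tau_def by (intro continuous_intros)

lemma defect_nonneg: "defect n R t x \<ge> 0"
  unfolding defect_def by (intro mult_nonneg_nonneg sum_nonneg) auto

lemma defect_solution:
  assumes "sr_solution n R t (s, t0)"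
  shows "defect n R t s = 0"
proof (cases "n = 0")
  case False
  have "tau R t i s = t0" if "i \<in> {1..n}" for i
    using assms that by (auto simp: sr_solution_def tau_def dist_commute)
  with False show ?thesis by (simp add: defect_def)
qed (simp add: defect_def)

text \<open>A vanishing mean absolute deviation forces every \<open>tau R t i x\<close> to equal the
  common mean, and that mean serves as the emission time \<open>t'\<close>.\<close>

lemma solution_of_defect_zero:
  fixes R :: "nat \<Rightarrow> 'a::metric_space"
  assumes "defect n R t x = 0"
  shows "\<exists>t'. sr_solution n R t (x, t')"
proof (cases "n = 0")
  case True
  then show ?thesis by (simp add: sr_solution_def)
next
  case False
  define m where "m = (1 / real n) * (\<Sum>j=1..n. tau R t j x)"
  have "(\<Sum>i=1..n. \<bar>tau R t i x - m\<bar>) = 0"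
    using assms False unfolding defect_def m_def[symmetric] by simp
  then have "tau R t i x = m" if "i \<in> {1..n}" for i
    using that by (simp add: sum_nonneg_eq_0_iff)
  then have "sr_solution n R t (x, m)"
    unfolding sr_solution_def tau_def by (auto simp: dist_commute algebra_simps)
  then show ?thesis ..
qed

lemma refining_covers_ball:
  assumes "refining_covers K \<B>" "\<rho> > 0" "(c, \<sigma>) \<in> \<B> (z, \<rho>)"
  shows "\<sigma> = \<rho> / 2" "dist c z \<le> K * \<rho>"
  using assms unfolding refining_covers_def by blast+

lemma refining_covers_cover:
  assumes covers: "refining_covers K \<B>" and "\<rho> > 0" and x: "x \<in> cball z \<rho>"
  obtains c where "(c, \<rho> / 2) \<in> \<B> (z, \<rho>)" "dist c x \<le> \<rho> / 2"
proof -
  have "cball z \<rho> \<subseteq> (\<Union>(c, \<sigma>)\<in>\<B> (z, \<rho>). cball c \<sigma>)"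
    using covers \<open>\<rho> > 0\<close> unfolding refining_covers_def by blast
  with x obtain c \<sigma> where "(c, \<sigma>) \<in> \<B> (z, \<rho>)" "x \<in> cball c \<sigma>" by blast
  with refining_covers_ball(1)[OF covers \<open>\<rho> > 0\<close>] that show ?thesis
    by (metis mem_cball)
qed

lemma refinement_radius: "B \<in> refinement n R t \<B> c0 r k \<Longrightarrow> snd B = r / 2 ^ k"
  by (cases k) auto

text \<open>Membership at a successor level includes the test for suspicion. The initial ball is not
  tested, hence \<open>k \<ge> 1\<close>.\<close>

lemma refinement_defect_le:
  assumes "c \<in> fst ` refinement n R t \<B> c0 r k" "k \<ge> 1"
  shows "defect n R t c \<le> 2 * (r / 2 ^ k)"
  using assms by (cases k) (auto simp: suspicious_def negative_def not_less)

text \<open>A center at level \<open>j + 1\<close> lies within \<open>K * r / 2 ^ j\<close> of the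
  center of a ball at level \<open>j\<close> whose cover contains it. The bound is the geometric sum
  of these steps over \<open>j < k\<close>.\<close>

lemma refinement_center_bound:
  fixes R :: "nat \<Rightarrow> 'a::metric_space"
  assumes covers: "refining_covers K \<B>" and "r > 0"
    and "c \<in> fst ` refinement n R t \<B> c0 r k"
  shows "dist c c0 \<le> K * r * (2 - 2 / 2 ^ k)"
  using assms(3)
proof (induction k arbitrary: c)
  case 0
  then show ?case by simp
next
  case (Suc k)
  then obtain B where B: "B \<in> refinement n R t \<B> c0 r k" "(c, r / 2 ^ Suc k) \<in> \<B> B"
    by auto
  obtain b where b: "B = (b, r / 2 ^ k)"
    using refinement_radius[OF B(1)] by (metis prod.collapse)
  have "dist c b \<le> K * (r / 2 ^ k)"
    using refining_covers_ball(2)[OF covers _ B(2)[unfolded b]] \<open>r > 0\<close> by simp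
  moreover have "dist b c0 \<le> K * r * (2 - 2 / 2 ^ k)"
    using Suc.IH[of b] B(1) b by force
  ultimately have "dist c c0 \<le> K * (r / 2 ^ k) + K * r * (2 - 2 / 2 ^ k)"
    using dist_triangle[of c c0 b] by linarith
  also have "\<dots> = K * r * (2 - 2 / 2 ^ Suc k)"
    by (simp add: field_simps)
  finally show ?case .
qed

text \<open>The source is never lost: a ball containing \<open>s\<close> is covered by its refining
  family, so some member of the family contains \<open>s\<close>, and this member passes the test
  for suspicion.\<close>

lemma refinement_contains_solution:
  fixes R :: "nat \<Rightarrow> 'a::metric_space"
  assumes covers: "refining_covers K \<B>" and "r > 0"
    and zero: "defect n R t s = 0" and "s \<in> cball c0 r"
  shows "\<exists>c. (c, r / 2 ^ k) \<in> refinement n R t \<B> c0 r k \<and> dist c s \<le> r / 2 ^ k"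
proof (induction k)
  case 0
  with \<open>s \<in> cball c0 r\<close> show ?case by simp
next
  case (Suc k)
  then obtain b where b: "(b, r / 2 ^ k) \<in> refinement n R t \<B> c0 r k" "dist b s \<le> r / 2 ^ k"
    by blast
  have "s \<in> cball b (r / 2 ^ k)" using b(2) by simp
  moreover have "r / 2 ^ k > 0" using \<open>r > 0\<close> by simp
  ultimately obtain c
    where "(c, r / 2 ^ k / 2) \<in> \<B> (b, r / 2 ^ k)" "dist c s \<le> r / 2 ^ k / 2"
    using refining_covers_cover[OF covers] by blast
  then have c: "(c, r / 2 ^ Suc k) \<in> \<B> (b, r / 2 ^ k)" "dist c s \<le> r / 2 ^ Suc k"
    by (simp_all add: mult.commute)
  \<comment> \<open>The Lipschitz bound is applied against the zero of the defect at
    \<open>s\<close>, which is within the new radius of \<open>c\<close>.\<close>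
  have "defect n R t c \<le> 2 * (r / 2 ^ Suc k)"
    using defect_lipschitz[of n R t c s] zero c(2) by linarith
  then have "suspicious n R t (c, r / 2 ^ Suc k)"
    by (simp add: suspicious_def negative_def)
  then show ?case using b(1) c by auto
qed

text \<open>Compactness turns the absence of a second zero of the defect into a positive lower bound
  away from \<open>s\<close>, which the shrinking radii eventually undercut.\<close>

lemma centers_eventually_close:
  fixes R :: "nat \<Rightarrow> 'a::metric_space"
  assumes proper: "\<And>(x::'a) e. compact (cball x e)"
    and unique: "\<And>s' t'. sr_solution n R t (s', t') \<Longrightarrow> s' = s"
    and covers: "refining_covers K \<B>" and "K \<ge> 0" "r > 0" "\<epsilon> > 0"
  shows "\<forall>\<^sub>F k in sequentially. \<forall>c \<in> fst ` refinement n R t \<B> c0 r k. dist c s < \<epsilon>"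
proof -
  \<comment> \<open>The radius \<open>2 * K * r\<close> bounds the distances of centers from
    \<open>c0\<close> at all levels at once. Removing an open ball keeps the set compact.\<close>
  define A where "A = cball c0 (2 * K * r) - ball s \<epsilon>"
  have "compact A" unfolding A_def by (intro compact_diff proper open_ball)
  have "\<exists>m>0. \<forall>x\<in>A. m \<le> defect n R t x"
  \<comment> \<open>A minimum is attained only on a nonempty set; for empty \<open>A\<close> the
    constant 1 serves.\<close>
  proof (cases "A = {}")
    case False
    then obtain a where a: "a \<in> A" "\<forall>x\<in>A. defect n R t a \<le> defect n R t x"
      using continuous_attains_inf[OF \<open>compact A\<close> _ continuous_on_defect] by blast
    have "defect n R t a \<noteq> 0"
    proof
      assume "defect n R t a = 0"
      then have "a = s" using solution_of_defect_zero unique by blast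
      with a(1) \<open>\<epsilon> > 0\<close> show False by (simp add: A_def)
    qed
    with defect_nonneg[of n R t a] have "defect n R t a > 0" by linarith
    with a(2) show ?thesis by blast
  qed (auto intro: exI[of _ "1::real"])
  then obtain m where m: "m > 0" "\<And>x. x \<in> A \<Longrightarrow> m \<le> defect n R t x" by blast
  have "(\<lambda>k. 2 * (r / 2 ^ k)) \<longlonglongrightarrow> 2 * 0"
    by (intro tendsto_mult tendsto_const LIMSEQ_divide_realpow_zero) simp
  then have "\<forall>\<^sub>F k in sequentially. 2 * (r / 2 ^ k) < m"
    by (rule order_tendstoD(2)) (use m(1) in simp)
  with eventually_ge_at_top[of 1] show ?thesis
  proof eventually_elim
    case (elim k)
    show ?case
    proof
      fix c assume c: "c \<in> fst ` refinement n R t \<B> c0 r k"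
      have "K * r * (2 - 2 / 2 ^ k) \<le> K * r * 2"
        using \<open>K \<ge> 0\<close> \<open>r > 0\<close> by (intro mult_left_mono) auto
      with refinement_center_bound[OF covers \<open>r > 0\<close> c] have "c \<in> cball c0 (2 * K * r)"
        by (simp add: dist_commute mult_ac)
      \<comment> \<open>Otherwise the defect at \<open>c\<close> would be at least \<open>m\<close>,
        yet it is at most twice the radius, which is below \<open>m\<close>.\<close>
      moreover have "c \<notin> A"
        using m(2)[of c] refinement_defect_le[OF c] elim by linarith
      ultimately show "dist c s < \<epsilon>" by (simp add: A_def dist_commute)
    qed
  qed
qed

theorem mainTheorem2:
  fixes R :: "nat \<Rightarrow> 'a::metric_space" and t :: "nat \<Rightarrow> real" and n :: nat
    and s c0 :: 'a and t0 r K1 \<delta> :: real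
    and \<B> :: "'a cball \<Rightarrow> 'a cball set" and \<C> :: "nat \<Rightarrow> 'a cball set" and z :: "nat \<Rightarrow> 'a"
  assumes proper: "\<And>(x::'a) e. compact (cball x e)"
    and n: "n \<ge> 1"
    and distinct: "inj_on R {1..n}"
    and times: "\<And>i. i \<in> {1..n} \<Longrightarrow> t i = t0 + dist (R i) s"
    and unique: "\<And>s' t'. sr_solution n R t (s', t') \<Longrightarrow> s' = s"
    and K1: "K1 \<ge> 1"
    and covers: "refining_covers K1 \<B>"
    and r: "r > 0"
    and source: "s \<in> cball c0 r"
    and process: "\<C> = refinement n R t \<B> c0 r"
    and centers: "\<And>k. k \<ge> 1 \<Longrightarrow> z k \<in> fst ` \<C> k"
    and \<delta>: "\<delta> > 0"
  shows "(\<exists>k\<ge>1. stop_criterion \<C> r \<delta> k) \<and>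
         dist (z (LEAST k. k \<ge> 1 \<and> stop_criterion \<C> r \<delta> k)) s < \<delta>"
proof -
  have zero: "defect n R t s = 0"
    using times by (intro defect_solution[of _ _ _ _ t0]) (simp add: sr_solution_def)
  have "(\<lambda>k. r / 2 ^ k) \<longlonglongrightarrow> 0"
    by (rule LIMSEQ_divide_realpow_zero) simp
  then have small: "\<forall>\<^sub>F k in sequentially. r / 2 ^ k < 1 / 3 * \<delta>"
    by (rule order_tendstoD(2)) (use \<delta> in simp)
  \<comment> \<open>Two centers within \<open>\<delta> / 3\<close> of \<open>s\<close> are less than
    \<open>2 / 3 * \<delta>\<close> apart, as the first stopping condition demands.\<close>
  have close: "\<forall>\<^sub>F k in sequentially. \<forall>c \<in> fst ` \<C> k. dist c s < \<delta> / 3"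
    unfolding process
    by (rule centers_eventually_close[OF proper unique covers]) (use K1 r \<delta> in auto)
  have "\<forall>\<^sub>F k in sequentially. k \<ge> 1 \<and> stop_criterion \<C> r \<delta> k"
    using eventually_ge_at_top[of 1] small close
  proof eventually_elim
    case (elim k)
    have "dist c' c'' < 2 / 3 * \<delta>"
      if "(c', r / 2 ^ k) \<in> \<C> k" "(c'', r / 2 ^ k) \<in> \<C> k" for c' c''
    proof -
      have "dist c' s < \<delta> / 3" "dist c'' s < \<delta> / 3"
        using elim(3) that by force+
      then show ?thesis using dist_triangle2[of c' c'' s] by linarith
    qed
    with elim show ?case by (simp add: stop_criterion_def)
  qed
  then have ex: "\<exists>k. k \<ge> 1 \<and> stop_criterion \<C> r \<delta> k"
    by (rule eventually_happens'[OF sequentially_bot])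
  define k where "k = (LEAST k. k \<ge> 1 \<and> stop_criterion \<C> r \<delta> k)"
  have k: "k \<ge> 1" "stop_criterion \<C> r \<delta> k"
    using LeastI_ex[OF ex] unfolding k_def by auto
  \<comment> \<open>The center \<open>c\<close> of a surviving ball around \<open>s\<close> links
    \<open>z k\<close> to \<open>s\<close>: the first stopping condition bounds
    \<open>dist (z k) c\<close> by \<open>2 / 3 * \<delta>\<close>, and the second bounds
    \<open>dist c s\<close> by the remaining third.\<close>
  obtain c where c: "(c, r / 2 ^ k) \<in> \<C> k" "dist c s \<le> r / 2 ^ k"
    using refinement_contains_solution[OF covers r zero source] process by blast
  \<comment> \<open>The choice of \<open>z k\<close> fixes only a center; the radius is determined
    by the level.\<close>
  have "(z k, r / 2 ^ k) \<in> \<C> k"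
    using centers[OF k(1)] refinement_radius[of _ n R t \<B> c0 r k] process
    by (metis imageE prod.collapse)
  then have "dist (z k) c < 2 / 3 * \<delta>" "r / 2 ^ k < 1 / 3 * \<delta>"
    using k(2) c(1) unfolding stop_criterion_def by blast+
  then have "dist (z k) s < \<delta>"
    using dist_triangle[of "z k" s c] c(2) by linarith
  with ex show ?thesis unfolding k_def by blast
qed

end
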